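(* Let $\alpha\in(0,1)$, let $\hat q_0\le\hat q_1\le\cdots\le\hat q_{\mathrm K}$ be the learned quantile functions, and for $m\in\{1,\dots,\mathrm K\}$ let $\mathcal J_m(x)$ be the shortest union of $m$ consecutive interquantile intervals at $x$, as defined in the context. Let $\mathcal D_{\mathrm{cal}}$ be the calibration set, let $(X,R)$ be a rollout point, and let $\hat m$ be the calibrated threshold defined in the context. If the calibration set $\mathcal D_{\mathrm{cal}}$ and the rollout point $(X,R)$ are exchangeable, then the prediction interval $\mathcal I=\mathcal J_{\hat m}$ satisfies $$\mathbb P\big[R\in\mathcal J_{\hat m}(X)\big]\ge 1-\alpha .$$
   Context: Setting. $\mathcal X$ is the space of prompt-response pairs and rewards are real numbers. $\alpha\in(0,1)$ is the target miscoverage rate and $\mathrm K\ge 1$ is an integer. A reward model trained on a training set $\mathcal D_{\mathrm{tr}}$ outputs, for each $x\in\mathcal X$, real numbers $\hat q_0(x)\le\hat q_1(x)\le\cdots\le\hat q_{\mathrm K}(x)$, where $\hat q_k(x)$ estimates the conditional quantile at level $k/\mathrm K$ of the reward given $x$. The calibration set $\mathcal D_{\mathrm{cal}}=\{(X_i,R_i)\}_{i=1}^{N}$, with $N=|\mathcal D_{\mathrm{cal}}|$, is held out from training. Exchangeability of the calibration set and the rollout point means that $(X_1,R_1),\dots,(X_N,R_N),(X,R)$ are exchangeable. Merged intervals. The interquantile intervals are $(\hat q_{k-1}(x),\hat q_k(x)]$, $k=1,\dots,\mathrm K$. For $m\in\{1,\dots,\mathrm K\}$, the shortest union of $m$ consecutive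 ones is $$\mathcal J_m(x)=\big(\hat q_{k_m}(x),\,\hat q_{k_m+m}(x)\big],\qquad k_m=\arg\min_{0\le k\le \mathrm K-m}\big(\hat q_{k+m}(x)-\hat q_k(x)\big).$$ Conformity score. For a sample $(x,r)$, $s(x,r)=\min\{m\in\{1,\dots,\mathrm K\}: r\in\mathcal J_m(x)\}$. Calibration threshold. $\hat m$ is the $n$-th smallest of the calibration scores $s(X_1,R_1),\dots,s(X_N,R_N)$, where $n=\lceil(1-\alpha)(1+N)\rceil$. The prediction interval at a new point $x$ is $\mathcal I(x)=\mathcal J_{\hat m}(x)$. The probability is over the joint law of the calibration points and $(X,R)$.
   Formalization: Added hypothesis: almost surely J_m(X) ⊆ J_{m+1}(X) for 1 ≤ m < K. Without it the claim is false: K=4, quantiles 0,1,11,13,15, α=1/2, N=1, (R_1,R) equal to (1/2,12) or (12,1/2) with probability 1/2 each gives coverage 0. *)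

theory Defs
  imports "HOL-Probability.Probability" "HOL-Library.Extended_Nat"
begin

text \<open>
  Throughout, \<open>q k x\<close> is the learned quantile of level \<open>k / K\<close> at the prompt-response pair \<open>x\<close>.
  The functions \<open>q\<close> are fixed: they come from training data disjoint from the calibration set.
\<close>

text \<open>Ties in the arg min are broken by taking the smallest minimiser.\<close>

definition merge_index :: "(nat \<Rightarrow> 'x \<Rightarrow> real) \<Rightarrow> nat \<Rightarrow> nat \<Rightarrow> 'x \<Rightarrow> nat" where
  "merge_index q K m x =
     (LEAST k. is_arg_min (\<lambda>k. q (k + m) x - q k x) (\<lambda>k. k \<le> K - m) k)"

definition merged_interval :: "(nat \<Rightarrow> 'x \<Rightarrow> real) \<Rightarrow> nat \<Rightarrow> nat \<Rightarrow> 'x \<Rightarrow> real set" where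
  "merged_interval q K m x =
     {q (merge_index q K m x) x <.. q (merge_index q K m x + m) x}"

text \<open>
  A reward lying in none of the merged intervals has score \<open>\<infinity>\<close>, the infimum of the empty set
  in \<^typ>\<open>enat\<close>; otherwise the infimum is a minimum.
\<close>

definition conformity_score :: "(nat \<Rightarrow> 'x \<Rightarrow> real) \<Rightarrow> nat \<Rightarrow> 'x \<Rightarrow> real \<Rightarrow> enat" where
  "conformity_score q K x r = (INF m \<in> {m \<in> {1..K}. r \<in> merged_interval q K m x}. enat m)"

definition calibration_rank :: "real \<Rightarrow> nat \<Rightarrow> nat" where
  "calibration_rank \<alpha> N = nat \<lceil>(1 - \<alpha>) * (1 + real N)\<rceil>"

text \<open>
  The \<open>n\<close>-th smallest of the scores \<open>s 0, \<dots>, s (N - 1)\<close>, counted with multiplicity, where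
  \<open>n = calibration_rank \<alpha> N\<close> (and \<open>n \<ge> 1\<close> for \<open>\<alpha> < 1\<close>). If \<open>n > N\<close> there is no such score and
  the threshold is \<open>\<infinity>\<close>, as usual in conformal prediction.
\<close>

definition calibrated_threshold :: "real \<Rightarrow> nat \<Rightarrow> (nat \<Rightarrow> enat) \<Rightarrow> enat" where
  "calibrated_threshold \<alpha> N s =
     (let n = calibration_rank \<alpha> N
      in if n \<le> N then sort (map s [0..<N]) ! (n - 1) else \<infinity>)"

text \<open>The infinite threshold excludes no reward.\<close>

definition prediction_interval :: "(nat \<Rightarrow> 'x \<Rightarrow> real) \<Rightarrow> nat \<Rightarrow> enat \<Rightarrow> 'x \<Rightarrow> real set" where
  "prediction_interval q K t x = (case t of enat m \<Rightarrow> merged_interval q K m x | \<infinity> \<Rightarrow> UNIV)"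

definition exchangeable ::
  "'w measure \<Rightarrow> 's measure \<Rightarrow> 'i set \<Rightarrow> ('i \<Rightarrow> 'w \<Rightarrow> 's) \<Rightarrow> bool" where
  "exchangeable M S I Z \<longleftrightarrow>
     (\<forall>i\<in>I. Z i \<in> M \<rightarrow>\<^sub>M S) \<and>
     (\<forall>p. p permutes I \<longrightarrow>
        distr M (Pi\<^sub>M I (\<lambda>_. S)) (\<lambda>\<omega>. \<lambda>i\<in>I. Z (p i) \<omega>) =
        distr M (Pi\<^sub>M I (\<lambda>_. S)) (\<lambda>\<omega>. \<lambda>i\<in>I. Z i \<omega>))"

end

theory Submission
  imports Defs
begin

text \<open>
  The scores inherit exchangeability, so the number of calibration scores strictly below the score
  of the rollout point is less than \<open>n\<close> with probability at least \<open>n / (N + 1)\<close>. In that case the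
  score of the rollout point is at most the threshold, and nestedness puts the reward into the
  interval. The event is measurable because the scores take countably many values.
\<close>

section \<open>Ranks and order statistics of finite families\<close>

text \<open>If some index has at least \<open>n\<close> values strictly below its own, choose one,
  \<open>j\<close>, of least value. Everything strictly below \<open>v j\<close> then has rank below
  \<open>n\<close>, and there are at least \<open>n\<close> such indices. Strict comparison lets
  ties only lower ranks.\<close>

lemma card_rank_less_ge:
  fixes v :: "'i \<Rightarrow> 'v::linorder"
  assumes "finite I" "n \<le> card I"
  shows "n \<le> card {j \<in> I. card {i \<in> I. v i < v j} < n}"
proof (cases "{j \<in> I. \<not> card {i \<in> I. v i < v j} < n} = {}")
  case True
  then have "{j \<in> I. card {i \<in> I. v i < v j} < n} = I" by blast
  with assms show ?thesis by simp
next
  case False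
  define B where "B = {j \<in> I. \<not> card {i \<in> I. v i < v j} < n}"
  have "finite B" "B \<noteq> {}" using assms False by (auto simp: B_def)
  then obtain j where j: "j \<in> B" "\<And>i. i \<in> B \<Longrightarrow> v j \<le> v i"
    using ex_is_arg_min_if_finite[of B v] by (auto simp: is_arg_min_linorder)
  have "n \<le> card {i \<in> I. v i < v j}" using j(1) by (simp add: B_def)
  also have "\<dots> \<le> card {j \<in> I. card {i \<in> I. v i < v j} < n}"
    using j(2) assms(1) by (intro card_mono) (force simp: B_def)+
  finally show ?thesis .
qed

text \<open>Otherwise the \<open>k + 1\<close> entries at positions \<open>0\<close> to
  \<open>k\<close> of the sorted list would all lie below \<open>x\<close>.\<close>

lemma le_nth_sort:
  fixes x :: "'v::linorder"
  assumes "k < length xs" "card {i. i < length xs \<and> xs ! i < x} \<le> k"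
  shows "x \<le> sort xs ! k"
proof (rule ccontr)
  assume "\<not> x \<le> sort xs ! k"
  then have "sort xs ! i < x" if "i \<le> k" for i
    using sorted_nth_mono[OF sorted_sort that] assms(1) by (metis length_sort le_less_trans not_le)
  then have "{..k} \<subseteq> {i. i < length (sort xs) \<and> sort xs ! i < x}"
    using assms(1) by auto
  then have "card {..k} \<le> card {i. i < length (sort xs) \<and> sort xs ! i < x}"
    by (intro card_mono) auto
  \<comment> \<open>Counting by \<open>filter\<close> makes the count visibly invariant under
    sorting.\<close>
  also have "\<dots> = length (filter (\<lambda>y. y < x) (sort xs))"
    by (simp add: length_filter_conv_card)
  also have "\<dots> = length (filter (\<lambda>y. y < x) xs)"
    by (metis filter_sort length_sort)
  also have "\<dots> = card {i. i < length xs \<and> xs ! i < x}"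
    by (simp add: length_filter_conv_card)
  finally show False using assms(2) by simp
qed

section \<open>Exchangeability and the law of ranks\<close>

text \<open>The law of each permuted transformed family is the image of the law of the permuted
  original under the coordinatewise map \<open>V\<close>, so equal laws stay equal.\<close>

lemma exchangeable_compose:
  assumes Z: "exchangeable M S I Z" and V[measurable]: "V \<in> S \<rightarrow>\<^sub>M T"
  shows "exchangeable M T I (\<lambda>i \<omega>. V (Z i \<omega>))"
  unfolding exchangeable_def
proof (intro conjI allI impI ballI)
  show "(\<lambda>\<omega>. V (Z i \<omega>)) \<in> M \<rightarrow>\<^sub>M T" if "i \<in> I" for i
    using Z that V by (auto simp: exchangeable_def intro: measurable_compose)
next
  fix p assume p: "p permutes I"
  have *: "distr M (Pi\<^sub>M I (\<lambda>_. T)) (\<lambda>\<omega>. \<lambda>i\<in>I. V (Z (\<pi> i) \<omega>)) =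
      distr (distr M (Pi\<^sub>M I (\<lambda>_. S)) (\<lambda>\<omega>. \<lambda>i\<in>I. Z (\<pi> i) \<omega>)) (Pi\<^sub>M I (\<lambda>_. T))
        (\<lambda>z. \<lambda>i\<in>I. V (z i))" if "\<pi> permutes I" for \<pi>
  proof -
    have 1: "(\<lambda>\<omega>. \<lambda>i\<in>I. Z (\<pi> i) \<omega>) \<in> M \<rightarrow>\<^sub>M Pi\<^sub>M I (\<lambda>_. S)"
      using Z permutes_in_image[OF that] by (auto simp: exchangeable_def intro!: measurable_restrict)
    have 2: "(\<lambda>z. \<lambda>i\<in>I. V (z i)) \<in> Pi\<^sub>M I (\<lambda>_. S) \<rightarrow>\<^sub>M Pi\<^sub>M I (\<lambda>_. T)"
      by measurable
    show ?thesis
      unfolding distr_distr[OF 2 1] by (rule arg_cong[where f = "distr _ _"]) (auto simp: fun_eq_iff)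
  qed
  show "distr M (Pi\<^sub>M I (\<lambda>_. T)) (\<lambda>\<omega>. \<lambda>i\<in>I. V (Z (p i) \<omega>)) =
      distr M (Pi\<^sub>M I (\<lambda>_. T)) (\<lambda>\<omega>. \<lambda>i\<in>I. V (Z i \<omega>))"
    using *[OF p] *[OF permutes_id] Z p by (simp add: exchangeable_def)
qed

text \<open>A finite product of discrete countable spaces is discrete, so \<open>f\<close> may be
  arbitrary. This serves for the threshold, which is defined by sorting.\<close>

lemma measurable_countable_family:
  fixes V :: "'i \<Rightarrow> 'w \<Rightarrow> 'v::countable"
  assumes "finite I" "\<And>i. i \<in> I \<Longrightarrow> V i \<in> M \<rightarrow>\<^sub>M count_space UNIV"
  shows "(\<lambda>\<omega>. f (\<lambda>i\<in>I. V i \<omega>)) \<in> M \<rightarrow>\<^sub>M count_space UNIV"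
proof -
  have "(\<lambda>\<omega>. \<lambda>i\<in>I. V i \<omega>) \<in> M \<rightarrow>\<^sub>M Pi\<^sub>M I (\<lambda>_. count_space UNIV)"
    using assms(2) by (rule measurable_restrict)
  also have "Pi\<^sub>M I (\<lambda>_. count_space (UNIV :: 'v set)) = count_space (PiE I (\<lambda>_. UNIV))"
    using assms(1) by (intro count_space_PiM_finite) auto
  finally show ?thesis by (rule measurable_compose) simp
qed

text \<open>
  By exchangeability all ranks have the same law, and at least \<open>n\<close> indices have rank below \<open>n\<close>.
\<close>

lemma exchangeable_rank_prob_ge:
  fixes V :: "'i \<Rightarrow> 'w \<Rightarrow> 'v::{linorder, countable}"
  assumes "prob_space M" and fin: "finite I" and k: "k \<in> I" and n: "n \<le> card I"
    and exch: "exchangeable M (count_space UNIV) I V"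
  shows "real n \<le> real (card I) * \<P>(\<omega> in M. card {i \<in> I. V i \<omega> < V k \<omega>} < n)"
proof -
  interpret prob_space M by fact
  define E where "E j = {\<omega> \<in> space M. card {i \<in> I. V i \<omega> < V j \<omega>} < n}" for j
  \<comment> \<open>Every event \<open>E (p k)\<close> is the preimage of this one set under the
    family permuted by \<open>p\<close>, so its probability depends only on the permuted
    law.\<close>
  define G where "G = {z \<in> PiE I (\<lambda>_. UNIV :: 'v set). card {i \<in> I. z i < z k} < n}"
  have V: "V i \<in> M \<rightarrow>\<^sub>M count_space UNIV" if "i \<in> I" for i
    using exch that by (simp add: exchangeable_def)
  have PiM: "Pi\<^sub>M I (\<lambda>_. count_space (UNIV :: 'v set)) = count_space (PiE I (\<lambda>_. UNIV))"
    using fin by (intro count_space_PiM_finite) auto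
  have G: "G \<in> sets (Pi\<^sub>M I (\<lambda>_. count_space UNIV))"
    unfolding PiM by (auto simp: G_def)
  have E_law: "prob (E (p k)) =
      measure (distr M (Pi\<^sub>M I (\<lambda>_. count_space UNIV)) (\<lambda>\<omega>. \<lambda>i\<in>I. V (p i) \<omega>)) G"
    and E_sets: "E (p k) \<in> events"
    if p: "p permutes I" for p
  proof -
    have meas: "(\<lambda>\<omega>. \<lambda>i\<in>I. V (p i) \<omega>) \<in> M \<rightarrow>\<^sub>M Pi\<^sub>M I (\<lambda>_. count_space UNIV)"
      using V permutes_in_image[OF p] by (intro measurable_restrict) auto
    have "card {i \<in> I. V (p i) \<omega> < V (p k) \<omega>} = card {i \<in> I. V i \<omega> < V (p k) \<omega>}" for \<omega>
    proof -
      \<comment> \<open>Relabelling by the bijection \<open>p\<close> does not change how many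
        values lie below a given one.\<close>
      have "{i \<in> I. V i \<omega> < V (p k) \<omega>} = p ` {i \<in> I. V (p i) \<omega> < V (p k) \<omega>}"
        using permutes_in_image[OF p] permutes_inverses(1)[OF p]
        by (auto simp: image_iff) metis
      then show ?thesis using card_image[OF permutes_inj_on[OF p]] by simp
    qed
    moreover have "{i \<in> I. (\<lambda>i\<in>I. V (p i) \<omega>) i < (\<lambda>i\<in>I. V (p i) \<omega>) k} =
        {i \<in> I. V (p i) \<omega> < V (p k) \<omega>}" for \<omega>
      using k by auto
    ultimately have eq: "E (p k) = (\<lambda>\<omega>. \<lambda>i\<in>I. V (p i) \<omega>) -` G \<inter> space M"
      by (auto simp: E_def G_def)
    show "prob (E (p k)) =
      measure (distr M (Pi\<^sub>M I (\<lambda>_. count_space UNIV)) (\<lambda>\<omega>. \<lambda>i\<in>I. V (p i) \<omega>)) G"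
      unfolding eq using meas G by (simp add: measure_distr)
    show "E (p k) \<in> events"
      unfolding eq using meas G by (rule measurable_sets)
  qed
  have E_j: "prob (E j) = prob (E k)" "E j \<in> events" if "j \<in> I" for j
  proof -
    \<comment> \<open>This permutation sends \<open>k\<close> to \<open>j\<close>; comparing it with
      the identity equates the two probabilities.\<close>
    have p: "Transposition.transpose j k permutes I"
      using that k by (rule permutes_swap_id)
    show "prob (E j) = prob (E k)"
      using E_law[OF p] E_law[OF permutes_id] exch p by (simp add: exchangeable_def)
    show "E j \<in> events" using E_sets[OF p] by simp
  qed
  have "real n = (\<integral>\<omega>. real n \<partial>M)" by (simp add: prob_space)
  \<comment> \<open>The sum counts the indices of rank below \<open>n\<close>; the bound holds
    pointwise, and linearity of expectation then yields \<open>card I\<close> equal terms.\<close>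
  also have "\<dots> \<le> (\<integral>\<omega>. (\<Sum>j\<in>I. indicator (E j) \<omega>) \<partial>M)"
  proof (rule integral_mono)
    show "integrable M (\<lambda>\<omega>. \<Sum>j\<in>I. indicator (E j) \<omega> :: real)"
      using E_j by (intro Bochner_Integration.integrable_sum integrable_real_indicator)
        (auto simp: emeasure_eq_measure)
    fix \<omega> assume "\<omega> \<in> space M"
    then have "(\<Sum>j\<in>I. indicator (E j) \<omega> :: real) =
        real (card {j \<in> I. card {i \<in> I. V i \<omega> < V j \<omega>} < n})"
      using fin by (simp add: E_def indicator_def sum.If_cases Int_def)
    then show "real n \<le> (\<Sum>j\<in>I. indicator (E j) \<omega>)"
      using card_rank_less_ge[OF fin n, of "\<lambda>i. V i \<omega>"] by simp
  qed simp
  also have "\<dots> = (\<Sum>j\<in>I. prob (E j))"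
    using E_j by (subst Bochner_Integration.integral_sum)
      (auto simp: emeasure_eq_measure intro!: sum.cong)
  also have "\<dots> = real (card I) * prob (E k)"
    using E_j by simp
  finally show ?thesis by (simp add: E_def)
qed

section \<open>Merged intervals and scores: attained minima and measurability\<close>

lemma merge_index_le: "merge_index q K m x \<le> K - m"
proof -
  have "\<exists>k. is_arg_min (\<lambda>k. q (k + m) x - q k x) (\<lambda>k. k \<in> {..K - m}) k"
    by (rule ex_is_arg_min_if_finite) auto
  then have "is_arg_min (\<lambda>k. q (k + m) x - q k x) (\<lambda>k. k \<le> K - m) (merge_index q K m x)"
    unfolding merge_index_def by (auto intro: LeastI_ex)
  then show ?thesis by (simp add: is_arg_min_def)
qed

lemma measurable_merge_index:
  assumes q: "\<And>k. k \<le> K \<Longrightarrow> q k \<in> borel_measurable S" and m: "m \<le> K"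
  shows "merge_index q K m \<in> S \<rightarrow>\<^sub>M count_space UNIV"
proof -
  have "Measurable.pred S (\<lambda>x. is_arg_min (\<lambda>k. q (k + m) x - q k x) (\<lambda>k. k \<le> K - m) k)" for k
  proof (cases "k \<le> K - m")
    case True
    \<comment> \<open>Here \<open>m \<le> K\<close> guarantees \<open>i + m \<le> K\<close> despite
      truncated subtraction.\<close>
    have [measurable]: "q i \<in> borel_measurable S" "q (i + m) \<in> borel_measurable S"
      if "i \<in> {..K - m}" for i
      using q that m by auto
    have [measurable]: "q k \<in> borel_measurable S" "q (k + m) \<in> borel_measurable S"
      using q True m by auto
    have "Measurable.pred S (\<lambda>x. \<forall>j\<in>{..K - m}. q (k + m) x - q k x \<le> q (j + m) x - q j x)"
      by measurable
    then show ?thesis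
      using True by (simp add: is_arg_min_linorder Ball_def)
  qed (simp add: is_arg_min_def)
  then show ?thesis
    unfolding merge_index_def[abs_def] by (rule measurable_Least)
qed

text \<open>The endpoints have an index depending on \<open>x\<close>. Splitting over its finitely
  many values leaves comparisons with fixed measurable functions.\<close>

lemma pred_merged_interval:
  assumes q: "\<And>k. k \<le> K \<Longrightarrow> q k \<in> borel_measurable S" and m: "m \<le> K"
  shows "Measurable.pred (S \<Otimes>\<^sub>M borel) (\<lambda>p. snd p \<in> merged_interval q K m (fst p))"
proof -
  have [measurable]: "merge_index q K m \<in> S \<rightarrow>\<^sub>M count_space UNIV"
    using q m by (rule measurable_merge_index)
  have [measurable]: "q i \<in> borel_measurable S" "q (i + m) \<in> borel_measurable S"
    if "i \<in> {..K - m}" for i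
    using q that m by auto
  have "Measurable.pred (S \<Otimes>\<^sub>M borel) (\<lambda>p. \<exists>k\<in>{..K - m}.
      merge_index q K m (fst p) = k \<and> q k (fst p) < snd p \<and> snd p \<le> q (k + m) (fst p))"
    by measurable
  also have "(\<lambda>p. \<exists>k\<in>{..K - m}.
      merge_index q K m (fst p) = k \<and> q k (fst p) < snd p \<and> snd p \<le> q (k + m) (fst p)) =
      (\<lambda>p. snd p \<in> merged_interval q K m (fst p))"
    using merge_index_le by (auto simp: merged_interval_def fun_eq_iff)
  finally show ?thesis .
qed

lemma conformity_score_cases:
  obtains "conformity_score q K x r = \<infinity>" "\<And>m. m \<in> {1..K} \<Longrightarrow> r \<notin> merged_interval q K m x"
  | m where "m \<in> {1..K}" "r \<in> merged_interval q K m x" "conformity_score q K x r = enat m"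
proof (cases "\<exists>m\<in>{1..K}. r \<in> merged_interval q K m x")
  case True
  \<comment> \<open>The well-order of \<open>enat\<close> makes the infimum of a nonempty set
    attained.\<close>
  then have "conformity_score q K x r \<in> enat ` {m \<in> {1..K}. r \<in> merged_interval q K m x}"
    unfolding conformity_score_def by (blast intro: wellorder_InfI)
  then show ?thesis using that(2) by auto
next
  case False
  then have "{m \<in> {1..K}. r \<in> merged_interval q K m x} = {}" by blast
  then have "conformity_score q K x r = \<infinity>"
    unfolding conformity_score_def by (simp only: image_empty Inf_empty top_enat_def)
  with False that(1) show ?thesis by blast
qed

lemma measurable_conformity_score:
  assumes q: "\<And>k. k \<le> K \<Longrightarrow> q k \<in> borel_measurable S"
  shows "(\<lambda>p. conformity_score q K (fst p) (snd p)) \<in> S \<Otimes>\<^sub>M borel \<rightarrow>\<^sub>M count_space UNIV"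
proof -
  have [measurable]: "Measurable.pred (S \<Otimes>\<^sub>M borel)
      (\<lambda>p. m \<in> {1..K} \<and> snd p \<in> merged_interval q K m (fst p))" for m
    using pred_merged_interval[where q = q and K = K and m = m, OF q] by (cases "m \<in> {1..K}") auto
  \<comment> \<open>In this form, measurability follows from that of a least natural number
    satisfying measurable predicates.\<close>
  have eq: "conformity_score q K (fst p) (snd p) =
      (if \<exists>m. m \<in> {1..K} \<and> snd p \<in> merged_interval q K m (fst p)
       then enat (LEAST m. m \<in> {1..K} \<and> snd p \<in> merged_interval q K m (fst p)) else \<infinity>)" for p
  proof (cases rule: conformity_score_cases[of q K "fst p" "snd p"])
    case 1
    then show ?thesis by auto
  next
    case (2 m)
    have "m \<le> m'" if "m' \<in> {1..K}" "snd p \<in> merged_interval q K m' (fst p)" for m'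
    proof -
      have "conformity_score q K (fst p) (snd p) \<le> enat m'"
        unfolding conformity_score_def using that by (intro INF_lower) auto
      then show ?thesis using 2(3) by simp
    qed
    then have "(LEAST m. m \<in> {1..K} \<and> snd p \<in> merged_interval q K m (fst p)) = m"
      using 2 by (intro Least_equality) auto
    then show ?thesis using 2 by auto
  qed
  show ?thesis unfolding eq by measurable
qed

section \<open>Calibrated threshold and coverage\<close>

lemma calibrated_threshold_cases:
  assumes "0 < calibration_rank \<alpha> N"
  obtains "calibrated_threshold \<alpha> N s = \<infinity>" | i where "i < N" "calibrated_threshold \<alpha> N s = s i"
proof (cases "calibration_rank \<alpha> N \<le> N")
  case True
  then have "sort (map s [0..<N]) ! (calibration_rank \<alpha> N - 1) \<in> set (sort (map s [0..<N]))"
    using assms by (intro nth_mem) auto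
  with True that(2) show ?thesis by (auto simp: calibrated_threshold_def)
qed (use that(1) in \<open>simp add: calibrated_threshold_def\<close>)

lemma le_calibrated_threshold:
  assumes "0 < calibration_rank \<alpha> N" "card {i. i < N \<and> s i < x} < calibration_rank \<alpha> N"
  shows "x \<le> calibrated_threshold \<alpha> N s"
proof (cases "calibration_rank \<alpha> N \<le> N")
  case True
  have "{i. i < length (map s [0..<N]) \<and> map s [0..<N] ! i < x} = {i. i < N \<and> s i < x}" by auto
  then have "x \<le> sort (map s [0..<N]) ! (calibration_rank \<alpha> N - 1)"
    using True assms by (intro le_nth_sort) auto
  with True show ?thesis by (simp add: calibrated_threshold_def)
qed (simp add: calibrated_threshold_def)

text \<open>A finite score \<open>m'\<close> is attained, so \<open>r\<close> lies in the interval
  for \<open>m'\<close>; the chain of inclusions carries it up to the interval for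
  \<open>t\<close>.\<close>

lemma mem_prediction_interval:
  assumes nested: "\<And>m. m \<in> {1..<K} \<Longrightarrow> merged_interval q K m x \<subseteq> merged_interval q K (Suc m) x"
    and le: "conformity_score q K x r \<le> t" and t: "t = \<infinity> \<or> t \<in> enat ` {1..K}"
  shows "r \<in> prediction_interval q K t x"
proof (cases "t = \<infinity>")
  case False
  then obtain m where m: "t = enat m" "m \<in> {1..K}" using t by auto
  then obtain m' where m': "m' \<in> {1..K}" "r \<in> merged_interval q K m' x" "m' \<le> m"
    using le by (cases rule: conformity_score_cases[of q K x r]) auto
  \<comment> \<open>Keeping \<open>m \<le> K\<close> as a premise of the induction puts each
    intermediate \<open>j\<close> in \<open>{1..<K}\<close>, where \<open>nested\<close>
    applies.\<close>
  have "m \<le> K \<Longrightarrow> merged_interval q K m' x \<subseteq> merged_interval q K m x"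
    using m'(3)
  proof (induction m rule: dec_induct)
    case (step j)
    then show ?case using nested[of j] m'(1) by auto
  qed simp
  with m m' show ?thesis by (auto simp: prediction_interval_def)
qed (simp add: prediction_interval_def)

theorem theorem3p1:
  fixes M :: "'w measure" and S :: "'x measure"
    and q :: "nat \<Rightarrow> 'x \<Rightarrow> real" and K N :: nat and \<alpha> :: real
    and Xcal :: "nat \<Rightarrow> 'w \<Rightarrow> 'x" and Rcal :: "nat \<Rightarrow> 'w \<Rightarrow> real"
    and X :: "'w \<Rightarrow> 'x" and R :: "'w \<Rightarrow> real"
  assumes "prob_space M"
    and "0 < \<alpha>" "\<alpha> < 1" and "K \<ge> 1"
    and q_measurable: "\<And>k. k \<le> K \<Longrightarrow> q k \<in> borel_measurable S"
    and q_mono: "\<And>k x. k < K \<Longrightarrow> x \<in> space S \<Longrightarrow> q k x \<le> q (Suc k) x"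
    and exch: "exchangeable M (S \<Otimes>\<^sub>M borel) {..N}
        (\<lambda>i \<omega>. if i < N then (Xcal i \<omega>, Rcal i \<omega>) else (X \<omega>, R \<omega>))"
    (* Added hypothesis: each merged interval minimises length for its own m, so they need not
       be nested; coverage by the interval at the calibrated threshold can fail without it. *)
    and nested: "AE \<omega> in M. \<forall>m\<in>{1..<K}.
        merged_interval q K m (X \<omega>) \<subseteq> merged_interval q K (Suc m) (X \<omega>)"
  shows "\<P>(\<omega> in M.
           R \<omega> \<in> prediction_interval q K
             (calibrated_threshold \<alpha> N (\<lambda>i. conformity_score q K (Xcal i \<omega>) (Rcal i \<omega>)))
             (X \<omega>))
         \<ge> 1 - \<alpha>"
proof -
  interpret prob_space M by fact
  \<comment> \<open>Index \<open>N\<close> is the rollout point, so \<open>{..N}\<close> holds all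
    \<open>N + 1\<close> points.\<close>
  define Z where "Z = (\<lambda>i \<omega>. if i < N then (Xcal i \<omega>, Rcal i \<omega>) else (X \<omega>, R \<omega>))"
  define V where "V = (\<lambda>i \<omega>. conformity_score q K (fst (Z i \<omega>)) (snd (Z i \<omega>)))"
  define n where "n = calibration_rank \<alpha> N"
  define T where
    "T \<omega> = calibrated_threshold \<alpha> N (\<lambda>i. conformity_score q K (Xcal i \<omega>) (Rcal i \<omega>))" for \<omega>
  have "0 < (1 - \<alpha>) * (1 + real N)" using \<open>\<alpha> < 1\<close> by simp
  then have n_pos: "0 < n" by (simp add: n_def calibration_rank_def)
  have n_ge: "(1 - \<alpha>) * (1 + real N) \<le> real n" by (simp add: n_def calibration_rank_def) linarith
  \<comment> \<open>The product is at most the integer \<open>N + 1\<close>, hence so is its ceiling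
    \<open>n\<close>, as the rank bound requires.\<close>
  have "(1 - \<alpha>) * (1 + real N) \<le> 1 * (1 + real N)"
    using \<open>0 < \<alpha>\<close> by (intro mult_right_mono) auto
  then have n_le: "n \<le> card {..N}" by (simp add: n_def calibration_rank_def ceiling_le_iff)
  have V_exch: "exchangeable M (count_space UNIV) {..N} V"
    unfolding V_def using exch[folded Z_def] measurable_conformity_score[OF q_measurable]
    by (rule exchangeable_compose)
  \<comment> \<open>The threshold reads only indices below \<open>N\<close>, so it is a function of
    the whole score family on \<open>{..N}\<close>.\<close>
  have T_V: "T \<omega> = calibrated_threshold \<alpha> N (\<lambda>i\<in>{..N}. V i \<omega>)" for \<omega>
    unfolding T_def calibrated_threshold_def Let_def
    by (intro if_cong arg_cong[where f = "\<lambda>xs. sort xs ! _"] map_cong) (auto simp: V_def Z_def)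
  have T_measurable[measurable]: "T \<in> M \<rightarrow>\<^sub>M count_space UNIV"
    unfolding T_V[abs_def] using V_exch
    by (intro measurable_countable_family) (auto simp: exchangeable_def)
  have score_range: "conformity_score q K x r = \<infinity> \<or> conformity_score q K x r \<in> enat ` {1..K}" for x r
    by (rule conformity_score_cases[of q K x r]) auto
  have T_range: "T \<omega> = \<infinity> \<or> T \<omega> \<in> enat ` {1..K}" for \<omega>
    unfolding T_def using n_pos[unfolded n_def]
    by (rule calibrated_threshold_cases[where s = "\<lambda>i. conformity_score q K (Xcal i \<omega>) (Rcal i \<omega>)"])
      (use score_range in auto)
  have "Z N \<in> M \<rightarrow>\<^sub>M S \<Otimes>\<^sub>M borel"
    using exch[folded Z_def] by (simp add: exchangeable_def)
  then have XR: "(\<lambda>\<omega>. (X \<omega>, R \<omega>)) \<in> M \<rightarrow>\<^sub>M S \<Otimes>\<^sub>M borel"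
    by (simp add: Z_def)
  have [measurable]: "Measurable.pred M (\<lambda>\<omega>. R \<omega> \<in> merged_interval q K m (X \<omega>))"
    if "m \<in> {1..K}" for m
    using measurable_compose[OF XR pred_merged_interval[OF q_measurable]] that by auto
  \<comment> \<open>The coverage event splits over the finitely many possible values of
    \<open>T\<close>.\<close>
  have "Measurable.pred M (\<lambda>\<omega>. T \<omega> = \<infinity> \<or>
      (\<exists>m\<in>{1..K}. T \<omega> = enat m \<and> R \<omega> \<in> merged_interval q K m (X \<omega>)))"
    by measurable
  also have "(\<lambda>\<omega>. T \<omega> = \<infinity> \<or> (\<exists>m\<in>{1..K}. T \<omega> = enat m \<and> R \<omega> \<in> merged_interval q K m (X \<omega>))) =
      (\<lambda>\<omega>. R \<omega> \<in> prediction_interval q K (T \<omega>) (X \<omega>))"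
    using T_range by (fastforce simp: prediction_interval_def split: enat.split)
  finally have event: "{\<omega> \<in> space M. R \<omega> \<in> prediction_interval q K (T \<omega>) (X \<omega>)} \<in> events"
    by measurable
  have cover: "R \<omega> \<in> prediction_interval q K (T \<omega>) (X \<omega>)"
    if nest: "\<forall>m\<in>{1..<K}. merged_interval q K m (X \<omega>) \<subseteq> merged_interval q K (Suc m) (X \<omega>)"
      and rank: "card {i \<in> {..N}. V i \<omega> < V N \<omega>} < n" for \<omega>
  proof (rule mem_prediction_interval)
    \<comment> \<open>Strictness removes \<open>N\<close> itself: the rank among all
      \<open>N + 1\<close> points counts calibration scores only.\<close>
    have "{i \<in> {..N}. V i \<omega> < V N \<omega>} = {i. i < N \<and> V i \<omega> < V N \<omega>}"
      by (auto simp: le_less)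
    also have "\<dots> = {i. i < N \<and>
        conformity_score q K (Xcal i \<omega>) (Rcal i \<omega>) < conformity_score q K (X \<omega>) (R \<omega>)}"
      by (auto simp: V_def Z_def)
    finally show "conformity_score q K (X \<omega>) (R \<omega>) \<le> T \<omega>"
      unfolding T_def using n_pos rank by (intro le_calibrated_threshold) (auto simp: n_def)
  qed (use nest T_range in auto)
  have "(1 - \<alpha>) * (1 + real N) \<le> real n" by (fact n_ge)
  also have "\<dots> \<le> real (card {..N}) * \<P>(\<omega> in M. card {i \<in> {..N}. V i \<omega> < V N \<omega>} < n)"
    using n_le V_exch by (intro exchangeable_rank_prob_ge prob_space_axioms) auto
  also have "\<dots> = \<P>(\<omega> in M. card {i \<in> {..N}. V i \<omega> < V N \<omega>} < n) * (1 + real N)"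
    by simp
  finally have "1 - \<alpha> \<le> \<P>(\<omega> in M. card {i \<in> {..N}. V i \<omega> < V N \<omega>} < n)"
    by (rule mult_right_le_imp_le) simp
  \<comment> \<open>Nestedness is assumed almost surely, so the rank event is included in the
    coverage event up to a null set.\<close>
  also have "\<dots> \<le> \<P>(\<omega> in M. R \<omega> \<in> prediction_interval q K (T \<omega>) (X \<omega>))"
  proof (rule finite_measure_mono_AE[OF _ event])
    show "AE \<omega> in M. \<omega> \<in> {\<omega> \<in> space M. card {i \<in> {..N}. V i \<omega> < V N \<omega>} < n} \<longrightarrow>
        \<omega> \<in> {\<omega> \<in> space M. R \<omega> \<in> prediction_interval q K (T \<omega>) (X \<omega>)}"
      using nested by eventually_elim (use cover in blast)
  qed
  finally show ?thesis by (simp add: T_def)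
qed

end
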